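(* If $H$ is a retract of a finite graph $G$, then $B(H) \leq B(G)$.
   Context: A subgraph $H$ of $G$ is a retract of $G$ if there is a map $r: V(G)\to V(H)$ that is the identity on $V(H)$ and maps adjacent vertices of $G$ to adjacent or equal vertices of $H$ (a retraction). Bodyguards and Presidents is a two-player game on a finite simple graph $G$. One player controls a set of tokens called bodyguards, the other a single token called the president. First all bodyguards are placed on vertices (several may share a vertex), then the president is placed. The players then alternate turns, bodyguards first; on a player's turn, each token they control either moves to an adjacent vertex or stays put. The president is surrounded if every vertex of the open neighbourhood of the president's vertex is occupied by a bodyguard. The bodyguards win if there is a finite time after which, at the end of every bodyguard turn, the president is surrounded; otherwise the president wins. The bodyguard number $B(G)$ is the minimum number of bodyguards that guarantees a win for the bodyguards on $G$ (with $B(G)=0$ for the edgeless graph). *)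

theory Defs
  imports "Graph_Theory.Graph_Theory" "HOL-Library.FuncSet"
begin

text \<open>A finite simple graph is a \<^locale>\<open>pair_graph\<close>: finite, loop-free, without parallel arcs, and
  symmetric, an edge being represented by its two opposite arcs.\<close>

definition retraction :: "'a pair_pre_digraph \<Rightarrow> 'a pair_pre_digraph \<Rightarrow> ('a \<Rightarrow> 'a) \<Rightarrow> bool" where
  "retraction G H r \<longleftrightarrow>
     r \<in> pverts G \<rightarrow> pverts H \<and>
     (\<forall>v \<in> pverts H. r v = v) \<and>
     (\<forall>u v. (u, v) \<in> parcs G \<longrightarrow> r u = r v \<or> (r u, r v) \<in> parcs H)"

definition retract_of :: "'a pair_pre_digraph \<Rightarrow> 'a pair_pre_digraph \<Rightarrow> bool" where
  "retract_of H G \<longleftrightarrow> subgraph (with_proj H) (with_proj G) \<and> (\<exists>r. retraction G H r)"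

text \<open>The placement of \<open>k\<close> bodyguards is the list, of length \<open>k\<close>, of their vertices; the \<open>i\<close>-th entry is
  the vertex of the \<open>i\<close>-th bodyguard.\<close>

type_synonym 'a placement = "'a list"

definition placements :: "'a pair_pre_digraph \<Rightarrow> nat \<Rightarrow> 'a placement set" where
  "placements G k = {c. length c = k \<and> set c \<subseteq> pverts G}"

definition token_move :: "'a pair_pre_digraph \<Rightarrow> 'a \<Rightarrow> 'a \<Rightarrow> bool" where
  "token_move G u v \<longleftrightarrow> v = u \<or> (u, v) \<in> parcs G"

definition bodyguards_move :: "'a pair_pre_digraph \<Rightarrow> 'a placement \<Rightarrow> 'a placement \<Rightarrow> bool" where
  "bodyguards_move G c c' \<longleftrightarrow> list_all2 (token_move G) c c'"

definition open_neighbourhood :: "'a pair_pre_digraph \<Rightarrow> 'a \<Rightarrow> 'a set" where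
  "open_neighbourhood G v = {w. (v, w) \<in> parcs G}"

definition surrounded :: "'a pair_pre_digraph \<Rightarrow> 'a placement \<Rightarrow> 'a \<Rightarrow> bool" where
  "surrounded G c v \<longleftrightarrow> open_neighbourhood G v \<subseteq> set c"

text \<open>A play is given by sequences \<open>b\<close> and \<open>p\<close>: \<open>b 0\<close> and \<open>p 0\<close> are the initial placements, and in round
  \<open>n\<close> first the bodyguards move from \<open>b n\<close> to \<open>b (Suc n)\<close> and then the president moves from \<open>p n\<close> to
  \<open>p (Suc n)\<close>. Hence the position at the end of the bodyguard turn of round \<open>n\<close> is
  \<open>(b (Suc n), p n)\<close>.\<close>

definition president_legal :: "'a pair_pre_digraph \<Rightarrow> (nat \<Rightarrow> 'a) \<Rightarrow> bool" where
  "president_legal G p \<longleftrightarrow> p 0 \<in> pverts G \<and> (\<forall>n. token_move G (p n) (p (Suc n)))"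

definition bodyguards_legal :: "'a pair_pre_digraph \<Rightarrow> nat \<Rightarrow> (nat \<Rightarrow> 'a placement) \<Rightarrow> bool" where
  "bodyguards_legal G k b \<longleftrightarrow> b 0 \<in> placements G k \<and> (\<forall>n. bodyguards_move G (b n) (b (Suc n)))"

definition bodyguards_win_play ::
  "'a pair_pre_digraph \<Rightarrow> (nat \<Rightarrow> 'a placement) \<Rightarrow> (nat \<Rightarrow> 'a) \<Rightarrow> bool" where
  "bodyguards_win_play G b p \<longleftrightarrow> (\<exists>N. \<forall>n\<ge>N. surrounded G (b (Suc n)) (p n))"

text \<open>A bodyguard strategy consists of an initial placement and a function choosing the next placement
  from the whole history of the game, the list of the positions at the start of the rounds so far.\<close>

type_synonym 'a strategy = "'a placement \<times> (('a placement \<times> 'a) list \<Rightarrow> 'a placement)"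

definition history :: "(nat \<Rightarrow> 'a placement) \<Rightarrow> (nat \<Rightarrow> 'a) \<Rightarrow> nat \<Rightarrow> ('a placement \<times> 'a) list" where
  "history b p n = map (\<lambda>i. (b i, p i)) [0..<Suc n]"

definition follows :: "'a strategy \<Rightarrow> (nat \<Rightarrow> 'a placement) \<Rightarrow> (nat \<Rightarrow> 'a) \<Rightarrow> bool" where
  "follows s b p \<longleftrightarrow> b 0 = fst s \<and> (\<forall>n. b (Suc n) = snd s (history b p n))"

text \<open>The first conjunct is not implied by the second when the graph has no vertex: then there is no
  play at all.\<close>

definition winning_strategy :: "'a pair_pre_digraph \<Rightarrow> nat \<Rightarrow> 'a strategy \<Rightarrow> bool" where
  "winning_strategy G k s \<longleftrightarrow>
     fst s \<in> placements G k \<and>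
     (\<forall>b p. president_legal G p \<and> follows s b p \<longrightarrow>
        bodyguards_legal G k b \<and> bodyguards_win_play G b p)"

definition bodyguards_win :: "'a pair_pre_digraph \<Rightarrow> nat \<Rightarrow> bool" where
  "bodyguards_win G k \<longleftrightarrow> (\<exists>s. winning_strategy G k s)"

definition bodyguard_number :: "'a pair_pre_digraph \<Rightarrow> nat" where
  "bodyguard_number G = (LEAST k. bodyguards_win G k)"

text \<open>The minimum is attained: one bodyguard standing still on each vertex wins.\<close>

lemma bodyguards_win_card_verts:
  assumes "pair_graph G"
  shows "bodyguards_win G (card (pverts G))"
proof -
  interpret pair_graph G by fact
  obtain c where c: "set c = pverts G" "distinct c"
    using finite_distinct_list[OF pair_finite_verts] by blast
  then have len: "length c = card (pverts G)"
    using distinct_card by fastforce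
  have "winning_strategy G (card (pverts G)) (c, \<lambda>_. c)"
    unfolding winning_strategy_def
  proof (intro conjI allI impI)
    show "fst (c, \<lambda>_. c) \<in> placements G (card (pverts G))"
      using c len by (simp add: placements_def)
  next
    fix b p
    assume "president_legal G p \<and> follows (c, \<lambda>_. c) b p"
    then have b: "b n = c" for n
      by (cases n) (auto simp: follows_def)
    show "bodyguards_legal G (card (pverts G)) b"
      using c len
      by (auto simp: bodyguards_legal_def b placements_def bodyguards_move_def token_move_def
          intro: list_all2_refl)
    show "bodyguards_win_play G b p"
      using c by (auto simp: bodyguards_win_play_def b surrounded_def open_neighbourhood_def
          dest: in_arcsD2)
  qed
  then show ?thesis
    unfolding bodyguards_win_def by blast
qed

lemma bodyguards_win_bodyguard_number:
  assumes "pair_graph G"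
  shows "bodyguards_win G (bodyguard_number G)"
  unfolding bodyguard_number_def
  using bodyguards_win_card_verts[OF assms] by (rule LeastI)

lemma bodyguard_number_edgeless:
  assumes "parcs G = {}"
  shows "bodyguard_number G = 0"
proof -
  have "winning_strategy G 0 ([], \<lambda>_. [])"
    unfolding winning_strategy_def
  proof (intro conjI allI impI)
    show "fst ([], \<lambda>_. []) \<in> placements G 0"
      by (simp add: placements_def)
  next
    fix b p
    assume "president_legal G p \<and> follows ([], \<lambda>_. []) b p"
    then have b: "b n = []" for n
      by (cases n) (auto simp: follows_def)
    show "bodyguards_legal G 0 b"
      by (simp add: bodyguards_legal_def b placements_def bodyguards_move_def)
    show "bodyguards_win_play G b p"
      using assms by (simp add: bodyguards_win_play_def surrounded_def open_neighbourhood_def)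
  qed
  then have "bodyguards_win G 0"
    unfolding bodyguards_win_def by blast
  then show ?thesis
    unfolding bodyguard_number_def by (rule Least_eq_0)
qed

end

theory Submission
  imports Defs
begin

text \<open>The bodyguards on \<open>H\<close> imagine the game on \<open>G\<close> against the same president, who walks in \<open>H\<close> and hence
  in \<open>G\<close>, and place themselves at the images under the retraction of the imagined bodyguards. Since the
  retraction fixes the neighbours of the president in \<open>H\<close>, whenever the imagined bodyguards surround
  the president in \<open>G\<close>, their images surround the president in \<open>H\<close>.\<close>

text \<open>The empty history stands for the moment before the president is placed, so that the
  initial placement and all later replies are produced by one function.\<close>

definition reply :: "'a strategy \<Rightarrow> ('a placement \<times> 'a) list \<Rightarrow> 'a placement" where
  "reply s h = (if h = [] then fst s else snd s h)"

text \<open>A strategy is deterministic, so the walk of the president alone determines the whole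
  imagined game.\<close>

definition simulate :: "'a strategy \<Rightarrow> 'a list \<Rightarrow> ('a placement \<times> 'a) list" where
  "simulate s ps = fold (\<lambda>v h. h @ [(reply s h, v)]) ps []"

lemma simulate_Nil [simp]: "simulate s [] = []"
  by (simp add: simulate_def)

lemma simulate_snoc [simp]:
  "simulate s (ps @ [v]) = simulate s ps @ [(reply s (simulate s ps), v)]"
  by (simp add: simulate_def)

text \<open>The range stops before \<open>n\<close>: the placement at the start of round
  \<open>n\<close> may depend only on the president's positions in earlier rounds.\<close>

definition simulated_play :: "'a strategy \<Rightarrow> (nat \<Rightarrow> 'a) \<Rightarrow> nat \<Rightarrow> 'a placement" where
  "simulated_play s p n = reply s (simulate s (map p [0..<n]))"

lemma simulate_eq_positions:
  "simulate s (map p [0..<n]) = map (\<lambda>i. (simulated_play s p i, p i)) [0..<n]"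
  by (induction n) (simp_all add: simulated_play_def)

lemma simulate_eq_history:
  "simulate s (map p [0..<Suc n]) = history (simulated_play s p) p n"
  unfolding history_def by (rule simulate_eq_positions)

lemma simulated_play_0: "simulated_play s p 0 = fst s"
  by (simp add: simulated_play_def reply_def)

lemma simulated_play_Suc:
  "simulated_play s p (Suc n) = snd s (simulate s (map p [0..<Suc n]))"
  by (simp add: simulated_play_def reply_def)

text \<open>This makes the imagined game a genuine play of \<open>s\<close>, to which the winning
  property of \<open>s\<close> applies.\<close>

lemma follows_simulated_play: "follows s (simulated_play s p) p"
  unfolding follows_def
  by (simp only: simulated_play_0 simulated_play_Suc simulate_eq_history simp_thms)

text \<open>The placements recorded in \<open>h\<close> are dropped: \<open>r\<close> need not be
  injective, so the imagined bodyguards cannot be read off from their images and are recomputed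
  instead.\<close>

definition image_strategy :: "('a \<Rightarrow> 'a) \<Rightarrow> 'a strategy \<Rightarrow> 'a strategy" where
  "image_strategy r s = (map r (fst s), \<lambda>h. map r (snd s (simulate s (map snd h))))"

lemma follows_image_strategy:
  assumes "follows (image_strategy r s) b p"
  shows "b n = map r (simulated_play s p n)"
proof (cases n)
  case 0
  then show ?thesis
    using assms by (simp add: follows_def image_strategy_def simulated_play_0)
next
  case (Suc m)
  have "map snd (history b p m) = map p [0..<Suc m]"
    by (simp add: history_def)
  then show ?thesis
    using assms Suc by (simp add: follows_def image_strategy_def simulated_play_Suc)
qed

lemma president_legal_mono:
  assumes "president_legal H p" and "pverts H \<subseteq> pverts G" and "parcs H \<subseteq> parcs G"
  shows "president_legal G p"
  using assms by (auto simp: president_legal_def token_move_def)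

lemma placements_retraction:
  assumes "retraction G H r" and "c \<in> placements G k"
  shows "map r c \<in> placements H k"
  using assms by (auto simp: retraction_def placements_def)

text \<open>If \<open>r\<close> collapses the arc along which a bodyguard moves, its image stays
  put, which is also a legal move.\<close>

lemma bodyguards_move_retraction:
  assumes "retraction G H r" and "bodyguards_move G c c'"
  shows "bodyguards_move H (map r c) (map r c')"
  using assms(2) unfolding bodyguards_move_def list_all2_map1 list_all2_map2
  by (rule list_all2_mono) (use assms(1) in \<open>fastforce simp: retraction_def token_move_def\<close>)

lemma surrounded_retraction:
  assumes "pair_graph H" and "retraction G H r" and "parcs H \<subseteq> parcs G"
    and "surrounded G c v"
  shows "surrounded H (map r c) v"
proof -
  interpret pair_graph H by fact
  have "w \<in> r ` set c" if vw: "(v, w) \<in> parcs H" for w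
  proof -
    have "w \<in> set c"
      using assms(3,4) vw by (auto simp: surrounded_def open_neighbourhood_def)
    moreover have "r w = w"
      using assms(2) in_arcsD2[OF vw] by (simp add: retraction_def)
    ultimately show ?thesis
      by force
  qed
  then show ?thesis
    by (auto simp: surrounded_def open_neighbourhood_def)
qed

lemma winning_strategy_image_strategy:
  assumes "pair_graph H" and "retraction G H r"
    and "pverts H \<subseteq> pverts G" and "parcs H \<subseteq> parcs G"
    and win: "winning_strategy G k s"
  shows "winning_strategy H k (image_strategy r s)"
  unfolding winning_strategy_def
proof (intro conjI allI impI; (elim conjE)?)
  show "fst (image_strategy r s) \<in> placements H k"
    using win placements_retraction[OF assms(2)]
    by (simp add: winning_strategy_def image_strategy_def)
next
  fix b p
  assume p: "president_legal H p" and "follows (image_strategy r s) b p"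
  then have b: "b n = map r (simulated_play s p n)" for n
    by (intro follows_image_strategy)
  have G: "bodyguards_legal G k (simulated_play s p)" "bodyguards_win_play G (simulated_play s p) p"
    using win president_legal_mono[OF p assms(3,4)] follows_simulated_play[of s p]
    unfolding winning_strategy_def by blast+
  show "bodyguards_legal H k b"
    using G(1) placements_retraction[OF assms(2)] bodyguards_move_retraction[OF assms(2)]
    by (simp add: bodyguards_legal_def b)
  \<comment> \<open>The round from which the president is always surrounded in \<open>G\<close>
    serves for \<open>H\<close> as well.\<close>
  show "bodyguards_win_play H b p"
    using G(2) surrounded_retraction[OF assms(1,2,4)]
    unfolding bodyguards_win_play_def b by blast
qed

theorem theorem2p4:
  fixes G H :: "'a pair_pre_digraph"
  assumes "pair_graph G" and "pair_graph H" and "retract_of H G"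
  shows "bodyguard_number H \<le> bodyguard_number G"
proof -
  obtain r where r: "retraction G H r"
    and sub: "subgraph (with_proj H) (with_proj G)"
    using assms(3) by (auto simp: retract_of_def)
  have "pverts H \<subseteq> pverts G" "parcs H \<subseteq> parcs G"
    using sub by (auto simp: subgraph_def)
  \<comment> \<open>The minimum for \<open>G\<close> is attained, so there is a winning strategy to
    transfer with exactly that many bodyguards.\<close>
  then have "bodyguards_win H (bodyguard_number G)"
    using bodyguards_win_bodyguard_number[OF assms(1)]
      winning_strategy_image_strategy[OF assms(2) r]
    unfolding bodyguards_win_def by blast
  then show ?thesis
    unfolding bodyguard_number_def[of H] by (rule Least_le)
qed

end
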